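(* Let $h\ge1$ be an integer, $q$ a prime power, and let $\boldsymbol{\alpha}=(\alpha_1,\dots,\alpha_n)$, where $\alpha_1,\dots,\alpha_n$ are the distinct elements of $\Lambda_{h,q}$ (so $n=|\Lambda_{h,q}|$). For any integer $1\le k<n$ with $q\ge hk+1$, the set of subspaces of $\mathrm{PG}(hk-1,q)$ obtained from the generator matrix $$G_{h,k,q}(\boldsymbol{\alpha})=\begin{pmatrix}1&1&\cdots&1\\ \alpha_1&\alpha_2&\cdots&\alpha_n\\ \vdots&\vdots&&\vdots\\ \alpha_1^{hk-1}&\alpha_2^{hk-1}&\cdots&\alpha_n^{hk-1}\end{pmatrix}\in\mathbb{F}_{q^h}^{hk\times n}$$ of the code $\mathcal{S}_{h,k,q}(\boldsymbol{\alpha})$ coincides with the pseudo-arc $\mathcal{P}_{h,k,q}$.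
   Context: $\Lambda_{h,q}$ is a set of representatives of the orbits of size $h$ of $\mathbb{F}_{q^h}$ under the $q$-Frobenius automorphism $x\mapsto x^q$. The code is $\mathcal{S}_{h,k,q}(\boldsymbol{\alpha}):=\{(f(\alpha_1),\dots,f(\alpha_n)):f(x)\in\mathbb{F}_q[x],\ \deg f<hk\}\subseteq\mathbb{F}_{q^h}^n$. It is an $\mathbb{F}_q$-linear code of $\mathbb{F}_q$-dimension $hk$. A generator matrix of an $\mathbb{F}_q$-linear code $\mathcal{C}\subseteq\mathbb{F}_{q^h}^n$ of $\mathbb{F}_q$-dimension $hk$ is an $hk\times n$ matrix over $\mathbb{F}_{q^h}$ whose row space over $\mathbb{F}_q$ is $\mathcal{C}$. The subspaces obtained from a generator matrix $G$ are defined as follows. Fix an $\mathbb{F}_q$-basis $\{\omega_1,\dots,\omega_h\}$ of $\mathbb{F}_{q^h}$ and put $\boldsymbol{\omega}=(\omega_1,\dots,\omega_h)^\top$. The $j$-th column of $G$ can be written uniquely as $G_j\boldsymbol{\omega}$ with $G_j\in\mathbb{F}_q^{hk\times h}$. Let $\pi_j$ be the subspace of $\mathrm{PG}(hk-1,q)$ corresponding to the $\mathbb{F}_q$-column space of $G_j$ (it does not depend on the choice of the basis). The subspaces obtained from $G$ are $\pi_1,\dots,\pi_n$. The pseudo-arc: $\Sigma\simeq\mathrm{PG}(hk-1,q)$ is the canonical subgeometry of $\mathrm{PG}(hk-1,q^h)$, consisting of the points that can be represented by a vector of $\mathbb{F}_q^{hk}\setminus\{0\}$; it is the set of fixed points of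 the collineation $\Psi:\langle(x_1,\dots,x_{hk})\rangle_{\mathbb{F}_{q^h}}\mapsto\langle(x_1^q,\dots,x_{hk}^q)\rangle_{\mathbb{F}_{q^h}}$. For a point $P$, $X^*(P):=\langle P,P^\Psi,\dots,P^{\Psi^{h-1}}\rangle_{\mathbb{F}_{q^h}}$ and $X(P):=X^*(P)\cap\Sigma$. For $\alpha\in\mathbb{F}_{q^h}$, $P_\alpha:=\langle(1,\alpha,\dots,\alpha^{hk-1})\rangle_{\mathbb{F}_{q^h}}$. Then $\mathcal{P}_{h,k,q}:=\{X(P_\alpha):\alpha\in\Lambda_{h,q}\}$. *)

theory Defs
  imports
    "Jordan_Normal_Form.VS_Connect"
    "HOL-Combinatorics.Orbits"
    "HOL-Library.Cardinality"
    "HOL-Number_Theory.Prime_Powers"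
begin

text \<open>
  The field with \<open>q\<close> elements is a finite field type \<open>'f\<close>, its extension of degree \<open>h\<close> a finite
  field type \<open>'e\<close>, and the inclusion is an explicit field homomorphism \<open>emb\<close>.
\<close>

abbreviation lspan :: "nat \<Rightarrow> 'a::field vec set \<Rightarrow> 'a vec set" where
  "lspan N S \<equiv> LinearCombinations.module.span class_ring (module_vec TYPE('a) N) S"

definition ext_space :: "('f::field \<Rightarrow> 'e::field) \<Rightarrow> ('f, 'e) module" where
  "ext_space emb = \<lparr>carrier = UNIV, monoid.mult = (*), one = 1, zero = 0, add = (+),
     smult = (\<lambda>c x. emb c * x)\<rparr>"

definition ext_vec_space :: "('f::field \<Rightarrow> 'e::field) \<Rightarrow> nat \<Rightarrow> ('f, 'e vec) module" where
  "ext_vec_space emb n = \<lparr>carrier = carrier_vec n, monoid.mult = undefined, one = undefined,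
     zero = 0\<^sub>v n, add = (+), smult = (\<lambda>c v. emb c \<cdot>\<^sub>v v)\<rparr>"

lemma vectorspace_ext_space:
  assumes "field_hom emb"
  shows "vectorspace class_ring (ext_space emb)"
proof -
  interpret field_hom emb by fact
  have "abelian_group (ext_space emb)"
  proof (rule abelian_groupI)
    show "\<exists>y\<in>carrier (ext_space emb). y \<oplus>\<^bsub>ext_space emb\<^esub> x = \<zero>\<^bsub>ext_space emb\<^esub>" for x
      by (rule bexI[of _ "- x"]) (simp_all add: ext_space_def)
  qed (simp_all add: ext_space_def ac_simps)
  then have "Module.module class_ring (ext_space emb)"
    by (intro moduleI class_field[THEN field.axioms(1), THEN domain.axioms(1)]) (simp_all add: ext_space_def algebra_simps hom_distribs)
  then show ?thesis
    by (intro vectorspace.intro class_field)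
qed

lemma vectorspace_ext_vec_space:
  assumes "field_hom emb"
  shows "vectorspace class_ring (ext_vec_space emb n)"
proof -
  interpret field_hom emb by fact
  have "abelian_group (ext_vec_space emb n)"
  proof (rule abelian_groupI)
    show "\<exists>y\<in>carrier (ext_vec_space emb n). y \<oplus>\<^bsub>ext_vec_space emb n\<^esub> x = \<zero>\<^bsub>ext_vec_space emb n\<^esub>"
      if "x \<in> carrier (ext_vec_space emb n)" for x
      using that by (intro bexI[of _ "- x"]) (simp_all add: ext_vec_space_def)
  qed (auto simp: ext_vec_space_def intro: comm_add_vec)
  then have "Module.module class_ring (ext_vec_space emb n)"
    by (intro moduleI class_field[THEN field.axioms(1), THEN domain.axioms(1)])
      (auto simp: ext_vec_space_def add_smult_distrib_vec smult_add_distrib_vec hom_distribs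
         smult_smult_assoc)
  then show ?thesis
    by (intro vectorspace.intro class_field)
qed

definition ordered_basis :: "('f::field \<Rightarrow> 'e::field) \<Rightarrow> nat \<Rightarrow> 'e vec \<Rightarrow> bool" where
  "ordered_basis emb h \<omega> \<longleftrightarrow> \<omega> \<in> carrier_vec h \<and> distinct (list_of_vec \<omega>) \<and>
     vectorspace.basis class_ring (ext_space emb) (set (list_of_vec \<omega>))"

text \<open>
  \<^const>\<open>orbit\<close> collects the iterates with exponent at least \<open>1\<close>; the Frobenius map is a
  permutation of a finite field, so this is the full orbit, including the point itself.
\<close>

definition orbits_of_size :: "nat \<Rightarrow> nat \<Rightarrow> 'e::field set set" where
  "orbits_of_size h q = {B. \<exists>x. B = orbit (\<lambda>y. y ^ q) x \<and> card B = h}"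

definition orbit_representatives :: "nat \<Rightarrow> nat \<Rightarrow> 'e::field set \<Rightarrow> bool" where
  "orbit_representatives h q \<Lambda> \<longleftrightarrow>
     \<Lambda> \<subseteq> \<Union> (orbits_of_size h q) \<and> (\<forall>B \<in> orbits_of_size h q. \<exists>!x. x \<in> \<Lambda> \<inter> B)"

text \<open>The zero polynomial has \<^const>\<open>degree\<close> \<open>0\<close>, so it is admitted as soon as \<open>h * k \<ge> 1\<close>.\<close>

definition code_S :: "('f::field \<Rightarrow> 'e::field) \<Rightarrow> nat \<Rightarrow> nat \<Rightarrow> 'e vec \<Rightarrow> 'e vec set" where
  "code_S emb h k \<alpha> = {map_vec (poly (map_poly emb f)) \<alpha> | f. degree f < h * k}"

definition linear_code ::
    "('f::field \<Rightarrow> 'e::field) \<Rightarrow> nat \<Rightarrow> nat \<Rightarrow> 'e vec set \<Rightarrow> bool" where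
  "linear_code emb n d C \<longleftrightarrow> VectorSpace.subspace class_ring C (ext_vec_space emb n) \<and>
     vectorspace.dim class_ring ((ext_vec_space emb n)\<lparr>carrier := C\<rparr>) = d"

definition generator_matrix ::
    "('f::field \<Rightarrow> 'e::field) \<Rightarrow> nat \<Rightarrow> nat \<Rightarrow> 'e vec set \<Rightarrow> 'e mat \<Rightarrow> bool" where
  "generator_matrix emb n d C G \<longleftrightarrow> linear_code emb n d C \<and> G \<in> carrier_mat d n \<and>
     LinearCombinations.module.span class_ring (ext_vec_space emb n) (set (rows G)) = C"

definition matrix_G :: "nat \<Rightarrow> nat \<Rightarrow> 'e::field vec \<Rightarrow> 'e mat" where
  "matrix_G h k \<alpha> = mat (h * k) (dim_vec \<alpha>) (\<lambda>(i, j). (\<alpha> $ j) ^ i)"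

text \<open>
  A point of the projective space of an \<open>N\<close>-dimensional coordinate space is a line through the
  origin, as a set of vectors; a projective subspace is a set of points.
\<close>

definition pg_points :: "nat \<Rightarrow> 'a::field vec set set" where
  "pg_points N = {lspan N {v} | v. v \<in> carrier_vec N \<and> v \<noteq> 0\<^sub>v N}"

definition pg_subspace :: "nat \<Rightarrow> 'a::field vec set \<Rightarrow> 'a vec set set" where
  "pg_subspace N U = {Q \<in> pg_points N. Q \<subseteq> U}"

definition coord_mat :: "('f::field \<Rightarrow> 'e::field) \<Rightarrow> 'e vec \<Rightarrow> 'e vec \<Rightarrow> 'f mat" where
  "coord_mat emb \<omega> c =
     (THE M. M \<in> carrier_mat (dim_vec c) (dim_vec \<omega>) \<and> c = map_mat emb M *\<^sub>v \<omega>)"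

definition matrix_subspaces ::
    "('f::field \<Rightarrow> 'e::field) \<Rightarrow> 'e vec \<Rightarrow> 'e mat \<Rightarrow> 'f vec set set set" where
  "matrix_subspaces emb \<omega> G =
     {pg_subspace (dim_row G)
        (vec_space.col_space (dim_row G) (coord_mat emb \<omega> (col G j))) | j. j < dim_col G}"

definition canonical_subgeometry ::
    "('f::field \<Rightarrow> 'e::field) \<Rightarrow> nat \<Rightarrow> 'e vec set set" where
  "canonical_subgeometry emb N =
     {lspan N {map_vec emb v} | v. v \<in> carrier_vec N \<and> v \<noteq> 0\<^sub>v N}"

text \<open>The identification of the projective space over the subfield with the subgeometry.\<close>

definition subgeometry_point ::
    "('f::field \<Rightarrow> 'e::field) \<Rightarrow> nat \<Rightarrow> 'f vec set \<Rightarrow> 'e vec set" where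
  "subgeometry_point emb N Q = lspan N (map_vec emb ` Q)"

definition \<Psi> :: "nat \<Rightarrow> nat \<Rightarrow> 'e::field vec set \<Rightarrow> 'e vec set" where
  "\<Psi> N q P = lspan N (map_vec (\<lambda>x. x ^ q) ` P)"

lemma lspan_singleton:
  fixes v :: "'a::field vec"
  assumes v: "v \<in> carrier_vec N"
  shows "lspan N {v} = {c \<cdot>\<^sub>v v | c. True}"
proof -
  interpret vec_space "TYPE('a)" N .
  have lc: "lincomb a {v} = a v \<cdot>\<^sub>v v" for a
    using v by (simp add: lincomb_def)
  have 1: "\<exists>c. w = c \<cdot>\<^sub>v v" if w: "w \<in> span {v}" for w
  proof -
    obtain a A where A: "w = lincomb a A" "A \<subseteq> {v}"
      using in_spanE[OF w] by blast
    then consider "A = {}" | "A = {v}" by blast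
    then show ?thesis
    proof cases
      case 1
      then have "w = 0 \<cdot>\<^sub>v v" using A v by (auto simp: lincomb_def)
      then show ?thesis by blast
    next
      case 2
      then show ?thesis using A lc by blast
    qed
  qed
  have 2: "c \<cdot>\<^sub>v v \<in> span {v}" for c
    using v by (intro in_spanI[of _ "\<lambda>_. c" "{v}"]) (simp_all add: lc)
  show ?thesis
  proof (rule equalityI; rule subsetI)
    show "w \<in> {c \<cdot>\<^sub>v v | c. True}" if "w \<in> span {v}" for w
      using 1[OF that] by simp
    show "w \<in> span {v}" if w: "w \<in> {c \<cdot>\<^sub>v v | c. True}" for w
    proof -
      obtain c where c: "w = c \<cdot>\<^sub>v v"
        using w by auto
      show ?thesis
        unfolding c by (rule 2)
    qed
  qed
qed

lemma lspan_multiples: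
  fixes v :: "'a::field vec"
  assumes v: "v \<in> carrier_vec N" and S: "\<And>w. w \<in> S \<Longrightarrow> \<exists>c. w = c \<cdot>\<^sub>v v" and vS: "v \<in> S"
  shows "lspan N S = lspan N {v}"
proof -
  interpret vec_space "TYPE('a)" N .
  have "S \<subseteq> span {v}" unfolding lspan_singleton[OF v] using S by auto
  then have "span S \<subseteq> span {v}" using v by (intro span_subsetI) simp_all
  moreover have "span {v} \<subseteq> span S" using vS by (intro span_is_monotone) simp
  ultimately show ?thesis by (rule equalityI)
qed

lemma \<Psi>_point:
  fixes v :: "'e::field vec"
  assumes v: "v \<in> carrier_vec N"
  shows "\<Psi> N q (lspan N {v}) = lspan N {map_vec (\<lambda>x. x ^ q) v}"
  unfolding \<Psi>_def
proof (rule lspan_multiples)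
  have "map_vec (\<lambda>x. x ^ q) (c \<cdot>\<^sub>v v) = c ^ q \<cdot>\<^sub>v map_vec (\<lambda>x. x ^ q) v" for c
    by (auto simp: power_mult_distrib)
  then show "\<exists>c. w = c \<cdot>\<^sub>v map_vec (\<lambda>x. x ^ q) v"
    if "w \<in> map_vec (\<lambda>x. x ^ q) ` lspan N {v}" for w
    using that unfolding lspan_singleton[OF v] by auto
  have "v \<in> lspan N {v}" unfolding lspan_singleton[OF v] by (auto intro: exI[of _ 1])
  then show "map_vec (\<lambda>x. x ^ q) v \<in> map_vec (\<lambda>x. x ^ q) ` lspan N {v}"
    by (rule imageI)
qed (use v in simp)

lemma subgeometry_point_point:
  fixes emb :: "'f::field \<Rightarrow> 'e::field"
  assumes "field_hom emb" and v: "v \<in> carrier_vec N"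
  shows "subgeometry_point emb N (lspan N {v}) = lspan N {map_vec emb v}"
  unfolding subgeometry_point_def
proof (rule lspan_multiples)
  interpret field_hom emb by fact
  have "map_vec emb (c \<cdot>\<^sub>v v) = emb c \<cdot>\<^sub>v map_vec emb v" for c
    by (auto simp: hom_distribs)
  then show "\<exists>c. w = c \<cdot>\<^sub>v map_vec emb v" if "w \<in> map_vec emb ` lspan N {v}" for w
    using that unfolding lspan_singleton[OF v] by auto
  have "v \<in> lspan N {v}" unfolding lspan_singleton[OF v] by (auto intro: exI[of _ 1])
  then show "map_vec emb v \<in> map_vec emb ` lspan N {v}"
    by (rule imageI)
qed (use v in simp)

definition X_star :: "nat \<Rightarrow> nat \<Rightarrow> nat \<Rightarrow> 'e::field vec set \<Rightarrow> 'e vec set set" where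
  "X_star N q h P = pg_subspace N (lspan N (\<Union>i<h. (\<Psi> N q ^^ i) P))"

definition X_sub :: "('f::field \<Rightarrow> 'e::field) \<Rightarrow> nat \<Rightarrow> nat \<Rightarrow> nat \<Rightarrow> 'e vec set \<Rightarrow> 'e vec set set" where
  "X_sub emb N q h P = X_star N q h P \<inter> canonical_subgeometry emb N"

definition moment_point :: "nat \<Rightarrow> 'e::field \<Rightarrow> 'e vec set" where
  "moment_point N a = lspan N {vec N (\<lambda>i. a ^ i)}"

definition pseudo_arc ::
    "('f::field \<Rightarrow> 'e::field) \<Rightarrow> nat \<Rightarrow> nat \<Rightarrow> nat \<Rightarrow> 'e set \<Rightarrow> 'e vec set set set" where
  "pseudo_arc emb h k q \<Lambda> = {X_sub emb (h * k) q h (moment_point (h * k) a) | a. a \<in> \<Lambda>}"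

end

theory Submission
  imports Defs "HOL-Number_Theory.Residues"
begin

text \<open>
  Write \<open>F\<close> for the field with \<open>q\<close> elements, \<open>E\<close> for its extension of degree \<open>h\<close>, \<open>N = hk\<close>, and
  \<open>Tr x = x + x\<^sup>q + \<dots> + x^(q^(h-1))\<close> for the trace from \<open>E\<close> to \<open>F\<close>.

  The statement about subspaces concerns one column \<open>v = (1, \<alpha>, \<dots>, \<alpha>^(N-1))\<close> at a time, and both
  constructions turn out to produce the same \<open>F\<close>-subspace, namely
  \<open>{(Tr (l v\<^sub>1), \<dots>, Tr (l v\<^sub>N)) | l \<in> E}\<close>.

  \<^item> For the coordinate matrix \<open>M\<close>, given by \<open>v = M \<omega>\<close>, linearity of the trace over \<open>F\<close> yields
    \<open>Tr (l v) = M Tr (l \<omega>)\<close>. As the trace form is nondegenerate, the vector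
    \<open>(Tr (l \<omega>\<^sub>1), \<dots>, Tr (l \<omega>\<^sub>h))\<close> runs through all of \<open>F\<^sup>h\<close> when \<open>l\<close> runs through \<open>E\<close>, so that
    these are all the combinations of the columns of \<open>M\<close> (lemma \<open>col_space_coord_mat\<close>).

  \<^item> For the span of the conjugates \<open>v, v\<^sup>q, \<dots>\<close>, expanding the trace writes \<open>Tr (l v)\<close> as a
    combination of conjugates. Conversely, a combination of conjugates with entries in \<open>F\<close> is
    reproduced by multiplying it by some \<open>\<theta>\<close> with \<open>Tr \<theta> = 1\<close> and taking traces; since the trace is
    invariant under the Frobenius map, each summand can be rewritten as the trace of a multiple of
    \<open>v\<close> itself (lemma \<open>subfield_point_of_conjugate_span\<close>).

  That \<open>G\<close> generates a code of dimension \<open>hk\<close> is a root count: a polynomial over \<open>F\<close> that vanishes on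
  every representative vanishes on the union of their Frobenius orbits, which has \<open>hn > hk\<close> elements
  (lemma \<open>vanishing_on_representatives\<close>). Hence evaluation at \<open>\<alpha>\<close> is injective on polynomials of degree
  less than \<open>hk\<close>, and the rows of \<open>G\<close>, the images of the monomials, form a basis of the code.
\<close>

(* Polynomials are those over a type class; the record fields for polynomial rings over a
   carrier have the same names. *)
hide_const (open) up_ring.coeff up_ring.monom

section \<open>Finite fields and lines\<close>

lemma finite_field_power_card:
  fixes x :: "'a::{field,finite}"
  shows "x ^ CARD('a) = x"
proof (cases "x = 0")
  case False
  \<comment> \<open>Multiplication by \<open>x\<close> permutes the nonzero elements, so it does not change their product.\<close>
  define U where "U = (UNIV :: 'a set) - {0}"
  have "(\<Prod>y\<in>U. y) = (\<Prod>y\<in>U. x * y)"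
    by (rule prod.reindex_bij_betw[symmetric], rule bij_betwI[of _ _ _ "\<lambda>y. y / x"])
      (use False in \<open>auto simp: U_def\<close>)
  also have "\<dots> = x ^ card U * \<Prod>U"
    by (simp add: prod.distrib)
  finally have "x ^ card U = 1"
    by (simp add: U_def)
  moreover have "CARD('a) = Suc (card U)"
    unfolding U_def by (rule card.remove) auto
  ultimately show ?thesis
    by simp
qed simp

lemma lspan_singleton_subset_iff:
  fixes v :: "'a::field vec"
  assumes "v \<in> carrier_vec N" and "\<And>c u. u \<in> U \<Longrightarrow> c \<cdot>\<^sub>v u \<in> U"
  shows "lspan N {v} \<subseteq> U \<longleftrightarrow> v \<in> U"
proof -
  have "v = 1 \<cdot>\<^sub>v v"
    by simp
  then show ?thesis
    unfolding lspan_singleton[OF assms(1)] using assms(2) by blast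
qed

lemma \<Psi>_iterate_moment_point: "(\<Psi> N q ^^ i) (moment_point N a) = moment_point N (a ^ q ^ i)"
proof (induction i)
  case (Suc i)
  have "map_vec (\<lambda>x. x ^ q) (vec N (\<lambda>r. (a ^ q ^ i) ^ r)) = vec N (\<lambda>r. (a ^ q ^ Suc i) ^ r)"
    by (auto simp: vec_eq_iff mult_ac simp flip: power_mult)
  then show ?case
    using Suc by (simp add: moment_point_def \<Psi>_point)
qed simp

text \<open>
  The vector space underlying \<open>X\<^sup>*(P\<^sub>a)\<close> is the column space of the matrix whose columns are the
  conjugates of the moment vector of \<open>a\<close>. The summands are written \<open>(a\<^sup>r)^(q^i)\<close> rather than
  \<open>(a^(q^i))\<^sup>r\<close> so that they are visibly conjugates of the entries \<open>a\<^sup>r\<close>.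
\<close>

lemma conjugate_span_moment_point:
  fixes a :: "'a::field"
  shows
  "lspan N (\<Union>i<h. (\<Psi> N q ^^ i) (moment_point N a)) =
     {u \<in> carrier_vec N. \<exists>\<mu>. \<forall>r\<in>{..<N}. u $ r = (\<Sum>i<h. \<mu> i * (a ^ r) ^ q ^ i)}"
proof -
  interpret vec_space "TYPE('a)" N .
  define A where "A = mat N h (\<lambda>(r, i). (a ^ r) ^ q ^ i)"
  have A: "A \<in> carrier_mat N h"
    by (simp add: A_def)
  have point: "moment_point N (a ^ q ^ i) = span {col A i}" if "i < h" for i
  proof -
    have "vec N (\<lambda>r. (a ^ q ^ i) ^ r) = col A i"
      using that by (auto simp: vec_eq_iff A_def mult_ac simp flip: power_mult)
    then show ?thesis
      by (simp add: moment_point_def)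
  qed
  have cols: "set (cols A) = col A ` {..<h}"
    using A by (auto simp: cols_def)
  have carrier: "set (cols A) \<subseteq> carrier_vec N"
    using A cols_dim[of A] by auto
  have "span (\<Union>i<h. (\<Psi> N q ^^ i) (moment_point N a)) = span (\<Union>i<h. span {col A i})"
    by (simp add: \<Psi>_iterate_moment_point point)
  also have "\<dots> = span (set (cols A))"
  proof (rule equalityI)
    have "(\<Union>i<h. span {col A i}) \<subseteq> span (set (cols A))"
      by (intro UN_least span_is_monotone) (auto simp: cols)
    then show "span (\<Union>i<h. span {col A i}) \<subseteq> span (set (cols A))"
      using carrier by (intro span_subsetI) auto
    have "col A i \<in> span {col A i}" if "i < h" for i
      using A that in_own_span[of "{col A i}"] by auto
    then show "span (set (cols A)) \<subseteq> span (\<Union>i<h. span {col A i})"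
      unfolding cols by (intro span_is_monotone) auto
  qed
  also have "\<dots> = {u \<in> carrier_vec N. \<exists>x\<in>carrier_vec h. A *\<^sub>v x = u}"
    using col_space_eq[OF A] A by (simp add: col_space_def)
  also have "\<dots> = {u \<in> carrier_vec N. \<exists>\<mu>. \<forall>r\<in>{..<N}. u $ r = (\<Sum>i<h. \<mu> i * (a ^ r) ^ q ^ i)}"
  proof (rule Collect_cong, rule conj_cong[OF refl])
    fix u :: "'a vec" assume u: "u \<in> carrier_vec N"
    have entry: "(A *\<^sub>v x) $ r = (\<Sum>i<h. x $ i * (a ^ r) ^ q ^ i)"
      if "x \<in> carrier_vec h" "r < N" for x r
      using that by (simp add: A_def scalar_prod_def atLeast0LessThan mult.commute)
    show "(\<exists>x\<in>carrier_vec h. A *\<^sub>v x = u) \<longleftrightarrow>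
      (\<exists>\<mu>. \<forall>r\<in>{..<N}. u $ r = (\<Sum>i<h. \<mu> i * (a ^ r) ^ q ^ i))"
    proof
      assume "\<exists>x\<in>carrier_vec h. A *\<^sub>v x = u"
      then obtain x where "x \<in> carrier_vec h" "A *\<^sub>v x = u"
        by blast
      then show "\<exists>\<mu>. \<forall>r\<in>{..<N}. u $ r = (\<Sum>i<h. \<mu> i * (a ^ r) ^ q ^ i)"
        using entry by (intro exI[of _ "\<lambda>i. x $ i"]) auto
    next
      assume "\<exists>\<mu>. \<forall>r\<in>{..<N}. u $ r = (\<Sum>i<h. \<mu> i * (a ^ r) ^ q ^ i)"
      then obtain \<mu> where "\<forall>r\<in>{..<N}. u $ r = (\<Sum>i<h. \<mu> i * (a ^ r) ^ q ^ i)" ..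
      then have "A *\<^sub>v vec h \<mu> = u"
        using u A entry[of "vec h \<mu>"] by (intro eq_vecI) auto
      then show "\<exists>x\<in>carrier_vec h. A *\<^sub>v x = u"
        by (intro bexI[of _ "vec h \<mu>"]) auto
    qed
  qed
  finally show ?thesis .
qed

section \<open>The trace of an extension of finite fields\<close>

locale finite_field_extension =
  fixes emb :: "'f::{field,finite} \<Rightarrow> 'e::{field,finite}" and q h :: nat
  assumes hom: "field_hom emb"
    and card_sub: "CARD('f) = q"
    and card_ext: "CARD('e) = q ^ h"
    and q_primepow: "primepow q"
    and h_pos: "h \<ge> 1"
begin

sublocale field_hom emb
  by (rule hom)

definition tr :: "'e \<Rightarrow> 'e" where
  "tr x = (\<Sum>i<h. x ^ q ^ i)"

lemma q_gt_1: "q > 1"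
  using q_primepow primepow_gt_Suc_0 by fastforce

lemma prime_char: "prime CHAR('e)"
  by (simp add: prime_CHAR_semidom finite_imp_CHAR_pos)

text \<open>
  A power map is additive as soon as its exponent is a power of the characteristic. Both \<open>q\<close> and the
  order of the big field are powers of one prime, and the characteristic divides that order.
\<close>

lemma q_power_of_char: "\<exists>m. q = CHAR('e) ^ m"
proof -
  obtain p k where p: "prime p" "q = p ^ k"
    using q_primepow by (auto simp: primepow_def)
  have "CHAR('e) dvd p ^ (k * h)"
    using CHAR_dvd_CARD[where 'a = 'e] by (simp add: card_ext p power_mult)
  then have "CHAR('e) = p"
    using prime_char p(1) by (metis prime_dvd_power primes_dvd_imp_eq)
  then show ?thesis
    using p(2) by blast
qed

lemma frobenius_power_sum: "(\<Sum>x\<in>A. f x :: 'e) ^ q ^ i = (\<Sum>x\<in>A. f x ^ q ^ i)"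
proof -
  obtain m where "q = CHAR('e) ^ m"
    using q_power_of_char by blast
  then show ?thesis
    by (intro freshmans_dream_sum'[OF prime_char, of _ "m * i"]) (simp add: power_mult)
qed

lemma frobenius_power_add: "(x + y :: 'e) ^ q ^ i = x ^ q ^ i + y ^ q ^ i"
proof -
  obtain m where "q = CHAR('e) ^ m"
    using q_power_of_char by blast
  then show ?thesis
    by (intro freshmans_dream'[OF prime_char, of _ "m * i"]) (simp add: power_mult)
qed

lemma emb_frobenius: "emb c ^ q ^ i = emb c"
proof (induction i)
  case (Suc i)
  have "emb c ^ q ^ Suc i = (emb (c ^ q)) ^ q ^ i"
    by (simp add: power_mult hom_power)
  then show ?case
    using Suc finite_field_power_card[of c] by (simp add: card_sub)
qed simp

lemma ext_frobenius: "(x :: 'e) ^ q ^ h = x"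
  using finite_field_power_card[of x] by (simp add: card_ext)

text \<open>
  The subfield already consists of \<open>q\<close> roots of \<open>X\<^sup>q - X\<close>, so there is no room for another one.
\<close>

lemma frobenius_fixed_imp_subfield:
  assumes "(x :: 'e) ^ q = x"
  shows "x \<in> range emb"
proof (rule ccontr)
  assume x: "x \<notin> range emb"
  define p where "p = monom 1 q - monom (1 :: 'e) 1"
  have "coeff p q = 1"
    using q_gt_1 by (simp add: p_def)
  then have p: "p \<noteq> 0"
    by auto
  have deg: "degree p \<le> q"
    unfolding p_def using q_gt_1 by (intro degree_diff_le) (auto simp: degree_monom_eq)
  have "insert x (range emb) \<subseteq> {y. poly p y = 0}"
    using assms emb_frobenius[of _ 1] by (auto simp: p_def poly_monom)
  then have "card (insert x (range emb)) \<le> card {y. poly p y = 0}"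
    by (intro card_mono) auto
  also have "\<dots> \<le> q"
    using card_poly_roots_bound[OF p] deg by simp
  finally show False
    using x by (simp add: card_image inj_f card_sub)
qed

lemma tr_sum: "tr (\<Sum>x\<in>A. f x) = (\<Sum>x\<in>A. tr (f x))"
  by (simp add: tr_def frobenius_power_sum sum.swap[of _ A])

lemma tr_add: "tr (x + y) = tr x + tr y"
  by (simp add: tr_def frobenius_power_add sum.distrib)

lemma tr_emb_mult: "tr (emb c * x) = emb c * tr x"
  by (simp add: tr_def power_mult_distrib emb_frobenius sum_distrib_left)

lemma tr_frobenius: "tr (x ^ q) = tr x"
proof -
  have "tr (x ^ q) = (\<Sum>i<h. x ^ q ^ Suc i)"
    by (simp add: tr_def flip: power_mult)
  also have "\<dots> = tr x + x ^ q ^ h - x"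
    unfolding tr_def using sum.lessThan_Suc_shift[of "\<lambda>i. x ^ q ^ i" h] by (simp add: algebra_simps)
  finally show ?thesis
    by (simp add: ext_frobenius)
qed

lemma tr_frobenius_power: "tr (x ^ q ^ i) = tr x"
  by (induction i) (simp_all add: tr_frobenius power_mult mult.commute[of q])

lemma tr_in_subfield: "\<exists>c. tr x = emb c"
proof -
  have "tr x ^ q = tr (x ^ q)"
    using frobenius_power_sum[of _ "{..<h}" 1] by (simp add: tr_def flip: power_mult) (simp add: mult.commute)
  then show ?thesis
    using frobenius_fixed_imp_subfield[of "tr x"] by (auto simp: tr_frobenius)
qed

text \<open>
  As a polynomial in \<open>x\<close>, the trace has degree \<open>q^(h-1)\<close>, which is smaller than the order \<open>q\<^sup>h\<close> of the
  field. This is what makes the trace form nondegenerate.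
\<close>

lemma tr_nontrivial: "\<exists>x. tr x \<noteq> 0"
proof (rule ccontr)
  assume *: "\<nexists>x. tr x \<noteq> 0"
  define p where "p = (\<Sum>i<h. monom (1 :: 'e) (q ^ i))"
  have "coeff p (q ^ (h - 1)) = (\<Sum>i<h. if i = h - 1 then 1 else 0)"
    unfolding p_def coeff_sum using q_gt_1 by (intro sum.cong) auto
  then have p: "p \<noteq> 0"
    using h_pos by auto
  have "degree p \<le> q ^ (h - 1)"
    unfolding p_def using q_gt_1
    by (intro degree_sum_le) (auto simp: degree_monom_eq intro!: power_increasing)
  moreover have "poly p x = 0" for x
    using * by (simp add: p_def poly_sum poly_monom tr_def)
  then have "{x. poly p x = 0} = UNIV"
    by simp
  then have "q ^ h \<le> degree p"
    using card_poly_roots_bound[OF p] by (simp add: card_ext)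
  moreover have "q ^ (h - 1) < q ^ h"
    using q_gt_1 h_pos by (intro power_strict_increasing) auto
  ultimately show False
    by linarith
qed

lemma tr_eq_1_exists: "\<exists>\<theta>. tr \<theta> = 1"
proof -
  obtain x where x: "tr x \<noteq> 0"
    using tr_nontrivial by blast
  obtain c where c: "tr x = emb c"
    using tr_in_subfield by blast
  have "tr (emb (inverse c) * x) = emb (inverse c * c)"
    unfolding tr_emb_mult c hom_mult ..
  also have "inverse c * c = 1"
    using x c by (intro left_inverse) auto
  finally have "tr (emb (inverse c) * x) = 1"
    by simp
  then show ?thesis
    by blast
qed

text \<open>
  The intersection of the span of the conjugates of a vector \<open>c\<close> with the vectors over the subfield.
  The index set \<open>R\<close> is arbitrary: all entries are treated alike, and what matters is only that \<open>\<mu>\<close> and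
  \<open>l\<close> are the same for all of them.
\<close>

lemma subfield_point_of_conjugate_span:
  fixes c :: "'r \<Rightarrow> 'e" and w :: "'r \<Rightarrow> 'f"
  shows "(\<exists>\<mu>. \<forall>r\<in>R. emb (w r) = (\<Sum>i<h. \<mu> i * c r ^ q ^ i))
     \<longleftrightarrow> (\<exists>l. \<forall>r\<in>R. emb (w r) = tr (l * c r))"
proof
  assume "\<exists>l. \<forall>r\<in>R. emb (w r) = tr (l * c r)"
  then obtain l where "\<forall>r\<in>R. emb (w r) = tr (l * c r)" ..
  then show "\<exists>\<mu>. \<forall>r\<in>R. emb (w r) = (\<Sum>i<h. \<mu> i * c r ^ q ^ i)"
    by (intro exI[of _ "\<lambda>i. l ^ q ^ i"]) (simp add: tr_def power_mult_distrib)
next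
  assume "\<exists>\<mu>. \<forall>r\<in>R. emb (w r) = (\<Sum>i<h. \<mu> i * c r ^ q ^ i)"
  then obtain \<mu> where \<mu>: "\<And>r. r \<in> R \<Longrightarrow> emb (w r) = (\<Sum>i<h. \<mu> i * c r ^ q ^ i)"
    by blast
  obtain \<theta> where \<theta>: "tr \<theta> = 1"
    using tr_eq_1_exists by blast
  \<comment> \<open>Applying the Frobenius map another \<open>h - i\<close> times takes \<open>x^(q^i)\<close> to \<open>x\<close> and leaves the trace
    unchanged; this moves the conjugation from \<open>c\<close> to its coefficient.\<close>
  define l where "l = (\<Sum>i<h. (\<theta> * \<mu> i) ^ q ^ (h - i))"
  have shift: "tr (\<theta> * \<mu> i * x ^ q ^ i) = tr ((\<theta> * \<mu> i) ^ q ^ (h - i) * x)" if "i < h" for i x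
  proof -
    have "(x ^ q ^ i) ^ q ^ (h - i) = x"
      using that ext_frobenius[of x] by (simp flip: power_mult power_add)
    then show ?thesis
      using tr_frobenius_power[of "\<theta> * \<mu> i * x ^ q ^ i" "h - i"] by (simp add: power_mult_distrib)
  qed
  have "emb (w r) = tr (l * c r)" if r: "r \<in> R" for r
  proof -
    have "emb (w r) = tr (emb (w r) * \<theta>)"
      by (simp add: tr_emb_mult \<theta>)
    also have "emb (w r) * \<theta> = (\<Sum>i<h. \<theta> * \<mu> i * c r ^ q ^ i)"
      by (simp add: \<mu>[OF r] sum_distrib_left mult_ac)
    also have "tr \<dots> = tr (l * c r)"
      by (simp add: tr_sum shift l_def sum_distrib_right)
    finally show ?thesis .
  qed
  then show "\<exists>l. \<forall>r\<in>R. emb (w r) = tr (l * c r)"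
    by blast
qed

section \<open>Coordinates with respect to a basis\<close>

lemma ext_space_simps:
  "carrier (ext_space emb) = UNIV" "\<zero>\<^bsub>ext_space emb\<^esub> = 0"
  "x \<oplus>\<^bsub>ext_space emb\<^esub> y = x + y" "c \<odot>\<^bsub>ext_space emb\<^esub> x = emb c * x"
  by (simp_all add: ext_space_def)

lemma finsum_ext_space:
  assumes "finite A"
  shows "finsum (ext_space emb) f A = (\<Sum>x\<in>A. f x)"
proof -
  interpret vectorspace class_ring "ext_space emb"
    by (rule vectorspace_ext_space[OF hom])
  show ?thesis
    using assms by (induction A) (simp_all add: ext_space_simps)
qed

lemma ordered_basis_spans:
  assumes "ordered_basis emb h \<omega>"
  shows "\<exists>b. x = (\<Sum>j<h. emb (b j) * \<omega> $ j)"
proof -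
  interpret vectorspace class_ring "ext_space emb"
    by (rule vectorspace_ext_space[OF hom])
  have \<omega>: "\<omega> \<in> carrier_vec h" and dist: "distinct (list_of_vec \<omega>)"
    and basis: "basis (set (list_of_vec \<omega>))"
    using assms by (auto simp: ordered_basis_def)
  have set: "set (list_of_vec \<omega>) = (($) \<omega>) ` {..<h}" and inj: "inj_on (($) \<omega>) {..<h}"
    using \<omega> dist by (auto simp: set_list_of_vec vec_set_def inj_on_def distinct_conv_nth list_of_vec_index)
  have "x \<in> span (set (list_of_vec \<omega>))"
    using basis by (simp add: basis_def ext_space_simps)
  then obtain b where "x = lincomb b (set (list_of_vec \<omega>))"
    by (auto simp: finite_span ext_space_simps)
  also have "\<dots> = (\<Sum>y\<in>set (list_of_vec \<omega>). emb (b y) * y)"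
    by (simp add: lincomb_def finsum_ext_space ext_space_simps)
  also have "\<dots> = (\<Sum>j<h. emb (b (\<omega> $ j)) * \<omega> $ j)"
    unfolding set by (simp add: sum.reindex[OF inj])
  finally show ?thesis
    by (intro exI[of _ "\<lambda>j. b (\<omega> $ j)"])
qed

lemma card_coordinate_functions: "card ({..<h} \<rightarrow>\<^sub>E (UNIV :: 'f set)) = CARD('e)"
  by (simp add: card_PiE card_ext card_sub)

text \<open>
  There are as many coordinate functions as field elements, so it suffices that the basis spans.
  Restricting functions to the indices below \<open>h\<close> turns the coordinate functions into a finite set.
\<close>

lemma ordered_basis_coordinates_unique:
  assumes "ordered_basis emb h \<omega>"
    and eq: "(\<Sum>j<h. emb (b j) * \<omega> $ j) = (\<Sum>j<h. emb (b' j) * \<omega> $ j)" and "j < h"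
  shows "b j = b' j"
proof -
  define F where "F = {..<h} \<rightarrow>\<^sub>E (UNIV :: 'f set)"
  define L where "L b = (\<Sum>j<h. emb (b j) * \<omega> $ j)" for b
  have L_restrict: "L (restrict b {..<h}) = L b" for b
    unfolding L_def by (rule sum.cong) auto
  have "x \<in> L ` F" for x
  proof -
    obtain b where "x = L b"
      using ordered_basis_spans[OF assms(1)] unfolding L_def by blast
    then have "x = L (restrict b {..<h})"
      by (simp add: L_restrict)
    then show ?thesis
      by (auto simp: F_def)
  qed
  then have "L ` F = UNIV"
    by blast
  moreover have "finite F"
    by (auto simp: F_def intro: finite_PiE)
  ultimately have inj: "inj_on L F"
    using card_coordinate_functions by (intro eq_card_imp_inj_on) (auto simp: F_def)
  have "L (restrict b {..<h}) = L (restrict b' {..<h})"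
    unfolding L_restrict using eq by (simp add: L_def)
  then have "restrict b {..<h} = restrict b' {..<h}"
    using inj_on_eq_iff[OF inj, of "restrict b {..<h}" "restrict b' {..<h}"] by (simp add: F_def)
  then show ?thesis
    using \<open>j < h\<close> by (metis lessThan_iff restrict_apply)
qed

text \<open>
  Nondegeneracy of the trace form, in the form in which it is used: sending \<open>l\<close> to the vector of the
  \<open>Tr (l \<omega>\<^sub>j)\<close> is injective, because \<open>Tr (d \<omega>\<^sub>j) = 0\<close> for all \<open>j\<close> and some \<open>d \<noteq> 0\<close> would make the trace
  vanish identically. By counting it is surjective.
\<close>

lemma trace_coordinates_exist:
  assumes "ordered_basis emb h \<omega>"
  shows "\<exists>l. \<forall>j<h. tr (l * \<omega> $ j) = emb (y j)"
proof -
  define F where "F = {..<h} \<rightarrow>\<^sub>E (UNIV :: 'f set)"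
  define \<phi> where "\<phi> l = restrict (\<lambda>j. the_inv emb (tr (l * \<omega> $ j))) {..<h}" for l
  have emb_\<phi>: "emb (\<phi> l j) = tr (l * \<omega> $ j)" if "j < h" for l j
    using tr_in_subfield[of "l * \<omega> $ j"] that by (auto simp: \<phi>_def the_inv_f_f[OF inj_f])
  have "inj \<phi>"
  proof (rule injI, rule ccontr)
    fix l l' assume eq: "\<phi> l = \<phi> l'" and "l \<noteq> l'"
    define d where "d = l - l'"
    have split: "tr (l * x) = tr (l' * x) + tr (d * x)" for x
      unfolding tr_add[symmetric] d_def by (simp add: algebra_simps)
    have vanish: "tr (d * \<omega> $ j) = 0" if "j < h" for j
      using split[of "\<omega> $ j"] emb_\<phi>[OF that] eq by (metis add_cancel_right_right)
    have "tr z = 0" for z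
    proof -
      obtain b where b: "z / d = (\<Sum>j<h. emb (b j) * \<omega> $ j)"
        using ordered_basis_spans[OF assms] by blast
      have "z = d * (z / d)"
        using \<open>l \<noteq> l'\<close> by (simp add: d_def)
      also have "\<dots> = (\<Sum>j<h. emb (b j) * (d * \<omega> $ j))"
        unfolding b by (simp add: sum_distrib_left mult_ac)
      finally show ?thesis
        by (simp add: tr_sum tr_emb_mult vanish)
    qed
    then show False
      using tr_nontrivial by blast
  qed
  moreover have "\<phi> ` UNIV \<subseteq> F"
    unfolding \<phi>_def F_def by (rule image_subsetI, rule restrict_PiE_iff[THEN iffD2]) simp
  moreover have "finite F"
    by (auto simp: F_def intro: finite_PiE)
  ultimately have "\<phi> ` UNIV = F"
    using card_coordinate_functions by (intro card_subset_eq) (auto simp: card_image F_def)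
  moreover have "restrict y {..<h} \<in> F"
    by (auto simp: F_def)
  ultimately obtain l where l: "restrict y {..<h} = \<phi> l"
    by blast
  have "tr (l * \<omega> $ j) = emb (y j)" if "j < h" for j
    using emb_\<phi>[OF that, of l] that by (simp flip: l)
  then show ?thesis
    by blast
qed

text \<open>
  Existence and uniqueness of coordinates make the description in the definition of
  \<^const>\<open>coord_mat\<close> a proper one.
\<close>

lemma coord_mat_properties:
  assumes \<omega>: "ordered_basis emb h \<omega>"
  shows "coord_mat emb \<omega> c \<in> carrier_mat (dim_vec c) h"
    and "r < dim_vec c \<Longrightarrow> c $ r = (\<Sum>j<h. emb (coord_mat emb \<omega> c $$ (r, j)) * \<omega> $ j)"
proof -
  have dim: "dim_vec \<omega> = h"
    using \<omega> by (auto simp: ordered_basis_def)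
  have iff: "(M \<in> carrier_mat (dim_vec c) (dim_vec \<omega>) \<and> c = map_mat emb M *\<^sub>v \<omega>) \<longleftrightarrow>
    (M \<in> carrier_mat (dim_vec c) h \<and> (\<forall>r<dim_vec c. c $ r = (\<Sum>j<h. emb (M $$ (r, j)) * \<omega> $ j)))" for M
  proof (rule conj_cong)
    assume M: "M \<in> carrier_mat (dim_vec c) h"
    have entry: "(map_mat emb M *\<^sub>v \<omega>) $ r = (\<Sum>j<h. emb (M $$ (r, j)) * \<omega> $ j)" if "r < dim_vec c" for r
      using M that by (simp add: scalar_prod_def atLeast0LessThan dim)
    have "c = map_mat emb M *\<^sub>v \<omega> \<longleftrightarrow> (\<forall>r<dim_vec c. c $ r = (map_mat emb M *\<^sub>v \<omega>) $ r)"
      unfolding vec_eq_iff using M by simp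
    then show "c = map_mat emb M *\<^sub>v \<omega> \<longleftrightarrow> (\<forall>r<dim_vec c. c $ r = (\<Sum>j<h. emb (M $$ (r, j)) * \<omega> $ j))"
      using entry by simp
  qed (simp only: dim)
  obtain b where b: "\<And>x. x = (\<Sum>j<h. emb (b x j) * \<omega> $ j)"
    using ordered_basis_spans[OF \<omega>] by metis
  define M where "M = mat (dim_vec c) h (\<lambda>(r, j). b (c $ r) j)"
  have "\<exists>!M. M \<in> carrier_mat (dim_vec c) h \<and>
    (\<forall>r<dim_vec c. c $ r = (\<Sum>j<h. emb (M $$ (r, j)) * \<omega> $ j))"
  proof (rule ex1I[of _ M])
    show "M \<in> carrier_mat (dim_vec c) h \<and>
      (\<forall>r<dim_vec c. c $ r = (\<Sum>j<h. emb (M $$ (r, j)) * \<omega> $ j))"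
      using b by (simp add: M_def)
    fix M' assume M': "M' \<in> carrier_mat (dim_vec c) h \<and>
      (\<forall>r<dim_vec c. c $ r = (\<Sum>j<h. emb (M' $$ (r, j)) * \<omega> $ j))"
    show "M' = M"
    proof (rule eq_matI)
      fix r j assume "r < dim_row M" "j < dim_col M"
      then have r: "r < dim_vec c" and j: "j < h"
        by (auto simp: M_def)
      have "M' $$ (r, j) = b (c $ r) j"
        by (rule ordered_basis_coordinates_unique[OF \<omega> _ j]) (use M' r b[of "c $ r"] in simp)
      then show "M' $$ (r, j) = M $$ (r, j)"
        using r j by (simp add: M_def)
    qed (use M' in \<open>auto simp: M_def\<close>)
  qed
  from theI'[OF this] have *: "coord_mat emb \<omega> c \<in> carrier_mat (dim_vec c) h \<and>
    (\<forall>r<dim_vec c. c $ r = (\<Sum>j<h. emb (coord_mat emb \<omega> c $$ (r, j)) * \<omega> $ j))"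
    unfolding coord_mat_def iff .
  show "coord_mat emb \<omega> c \<in> carrier_mat (dim_vec c) h"
    and "r < dim_vec c \<Longrightarrow> c $ r = (\<Sum>j<h. emb (coord_mat emb \<omega> c $$ (r, j)) * \<omega> $ j)"
    using * by blast+
qed

lemma col_space_coord_mat:
  assumes \<omega>: "ordered_basis emb h \<omega>" and c: "c \<in> carrier_vec N"
  shows "vec_space.col_space N (coord_mat emb \<omega> c) =
    {w \<in> carrier_vec N. \<exists>l. \<forall>r\<in>{..<N}. emb (w $ r) = tr (l * c $ r)}"
proof -
  define M where "M = coord_mat emb \<omega> c"
  have M: "M \<in> carrier_mat N h"
    using coord_mat_properties(1)[OF \<omega>, of c] c by (simp add: M_def)
  have cM: "c $ r = (\<Sum>j<h. emb (M $$ (r, j)) * \<omega> $ j)" if "r < N" for r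
    using coord_mat_properties(2)[OF \<omega>, of r c] c that by (simp add: M_def)
  have key: "emb ((M *\<^sub>v y) $ r) = tr (l * c $ r)"
    if y: "y \<in> carrier_vec h" and l: "\<And>j. j < h \<Longrightarrow> tr (l * \<omega> $ j) = emb (y $ j)" and r: "r < N" for y l r
  proof -
    have "l * c $ r = (\<Sum>j<h. emb (M $$ (r, j)) * (l * \<omega> $ j))"
      by (simp add: cM[OF r] sum_distrib_left mult_ac)
    then have "tr (l * c $ r) = (\<Sum>j<h. emb (M $$ (r, j)) * emb (y $ j))"
      by (simp add: tr_sum tr_emb_mult l)
    also have "\<dots> = emb (\<Sum>j<h. M $$ (r, j) * y $ j)"
      by (simp add: hom_sum hom_mult)
    also have "(\<Sum>j<h. M $$ (r, j) * y $ j) = (M *\<^sub>v y) $ r"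
      using M y r by (auto simp: scalar_prod_def atLeast0LessThan intro!: sum.cong)
    finally show ?thesis ..
  qed
  have "(\<exists>y\<in>carrier_vec h. M *\<^sub>v y = w) \<longleftrightarrow> (\<exists>l. \<forall>r\<in>{..<N}. emb (w $ r) = tr (l * c $ r))"
    if w: "w \<in> carrier_vec N" for w
  \<comment> \<open>Every \<open>y\<close> is the vector of traces of some \<open>l\<close>, and every \<open>l\<close> yields such a vector \<open>y\<close>.\<close>
  proof
    assume "\<exists>y\<in>carrier_vec h. M *\<^sub>v y = w"
    then obtain y where y: "y \<in> carrier_vec h" "M *\<^sub>v y = w"
      by blast
    obtain l where "\<And>j. j < h \<Longrightarrow> tr (l * \<omega> $ j) = emb (y $ j)"
      using trace_coordinates_exist[OF \<omega>] by blast
    then show "\<exists>l. \<forall>r\<in>{..<N}. emb (w $ r) = tr (l * c $ r)"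
      using key y by (metis lessThan_iff)
  next
    assume "\<exists>l. \<forall>r\<in>{..<N}. emb (w $ r) = tr (l * c $ r)"
    then obtain l where l: "\<And>r. r < N \<Longrightarrow> emb (w $ r) = tr (l * c $ r)"
      by auto
    obtain z where z: "\<And>j. tr (l * \<omega> $ j) = emb (z j)"
      using choice[of "\<lambda>j c. tr (l * \<omega> $ j) = emb c"] tr_in_subfield by blast
    have "M *\<^sub>v vec h z = w"
    proof (rule eq_vecI)
      show "(M *\<^sub>v vec h z) $ r = w $ r" if "r < dim_vec w" for r
      proof -
        have "emb ((M *\<^sub>v vec h z) $ r) = emb (w $ r)"
          using that w z key[of "vec h z" l r] l[of r] by simp
        then show ?thesis
          by simp
      qed
    qed (use M w in auto)
    then show "\<exists>y\<in>carrier_vec h. M *\<^sub>v y = w"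
      by (intro bexI[of _ "vec h z"]) auto
  qed
  then show ?thesis
    using vec_space.col_space_eq[OF M] M by (auto simp: M_def)
qed

section \<open>The subspaces of the pseudo-arc\<close>

text \<open>
  A vector over the subfield lies in the column space if and only if its image lies in the span of
  the conjugates, since either condition says that its entries are \<open>Tr (l a\<^sup>r)\<close> for one \<open>l\<close>. The
  rest is the passage from vectors to projective points, which needs only that both sets of vectors
  are closed under scaling.
\<close>

lemma subgeometry_image_col_space:
  assumes \<omega>: "ordered_basis emb h \<omega>"
  shows "subgeometry_point emb N ` pg_subspace N
      (vec_space.col_space N (coord_mat emb \<omega> (vec N (\<lambda>r. a ^ r)))) =
    X_sub emb N q h (moment_point N a)"
proof -
  define W where "W = vec_space.col_space N (coord_mat emb \<omega> (vec N (\<lambda>r. a ^ r)))"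
  define U where "U = lspan N (\<Union>i<h. (\<Psi> N q ^^ i) (moment_point N a))"
  have W: "W = {w \<in> carrier_vec N. \<exists>l. \<forall>r\<in>{..<N}. emb (w $ r) = tr (l * a ^ r)}"
    unfolding W_def by (subst col_space_coord_mat[OF \<omega>]) auto
  have U: "U = {u \<in> carrier_vec N. \<exists>\<mu>. \<forall>r\<in>{..<N}. u $ r = (\<Sum>i<h. \<mu> i * (a ^ r) ^ q ^ i)}"
    unfolding U_def by (rule conjugate_span_moment_point)
  have mem: "map_vec emb w \<in> U \<longleftrightarrow> w \<in> W" if w: "w \<in> carrier_vec N" for w
  proof -
    have "map_vec emb w \<in> U \<longleftrightarrow>
      (\<exists>\<mu>. \<forall>r\<in>{..<N}. emb (w $ r) = (\<Sum>i<h. \<mu> i * (a ^ r) ^ q ^ i))"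
      using w by (simp add: U)
    then show ?thesis
      using w by (simp add: W subfield_point_of_conjugate_span)
  qed
  have scaleW: "c \<cdot>\<^sub>v w \<in> W" if wW: "w \<in> W" for c w
  proof -
    obtain l where "\<forall>r\<in>{..<N}. emb (w $ r) = tr (l * a ^ r)"
      using wW unfolding W by blast
    moreover have "w \<in> carrier_vec N"
      using wW by (simp add: W)
    ultimately have "\<forall>r\<in>{..<N}. emb ((c \<cdot>\<^sub>v w) $ r) = tr (emb c * l * a ^ r)"
      by (simp add: mult.assoc tr_emb_mult hom_mult)
    then show ?thesis
      using wW unfolding W by (intro CollectI conjI exI[of _ "emb c * l"]) auto
  qed
  have scaleU: "c \<cdot>\<^sub>v u \<in> U" if uU: "u \<in> U" for c u
  proof -
    obtain \<mu> where "\<forall>r\<in>{..<N}. u $ r = (\<Sum>i<h. \<mu> i * (a ^ r) ^ q ^ i)"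
      using uU unfolding U by blast
    moreover have "u \<in> carrier_vec N"
      using uU by (simp add: U)
    ultimately have "\<forall>r\<in>{..<N}. (c \<cdot>\<^sub>v u) $ r = (\<Sum>i<h. c * \<mu> i * (a ^ r) ^ q ^ i)"
      by (simp add: sum_distrib_left mult.assoc)
    then show ?thesis
      using uU unfolding U by (intro CollectI conjI exI[of _ "\<lambda>i. c * \<mu> i"]) auto
  qed
  define W' where "W' = {w \<in> carrier_vec N. w \<noteq> 0\<^sub>v N \<and> w \<in> W}"
  have "pg_subspace N W = (\<lambda>w. lspan N {w}) ` W'"
    unfolding pg_subspace_def pg_points_def W'_def
    using lspan_singleton_subset_iff[of _ N W, OF _ scaleW] by auto
  then have "subgeometry_point emb N ` pg_subspace N W = (\<lambda>w. lspan N {map_vec emb w}) ` W'"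
    using subgeometry_point_point[OF hom, of _ N] by (simp add: image_image W'_def)
  also have "\<dots> = pg_subspace N U \<inter> canonical_subgeometry emb N"
  proof -
    have "lspan N {map_vec emb w} \<in> pg_subspace N U \<longleftrightarrow> w \<in> W"
      if w: "w \<in> carrier_vec N" "w \<noteq> 0\<^sub>v N" for w
    proof -
      have "map_vec emb w \<in> carrier_vec N" "map_vec emb w \<noteq> 0\<^sub>v N"
        using w by (auto simp: vec_eq_iff)
      then have "lspan N {map_vec emb w} \<in> pg_points N"
        unfolding pg_points_def by blast
      then show ?thesis
        using lspan_singleton_subset_iff[of "map_vec emb w" N U] scaleU mem w by (simp add: pg_subspace_def)
    qed
    then show ?thesis
      unfolding canonical_subgeometry_def W'_def by auto
  qed
  finally show ?thesis
    by (simp add: W_def U_def X_sub_def X_star_def)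
qed

section \<open>The code and its generator matrix\<close>

lemma permutation_frobenius: "permutation (\<lambda>x :: 'e. x ^ q)"
proof -
  have "inj (\<lambda>x :: 'e. x ^ q)"
  proof (rule injI)
    fix x y :: 'e assume "x ^ q = y ^ q"
    then have "(x ^ q) ^ q ^ (h - 1) = (y ^ q) ^ q ^ (h - 1)"
      by simp
    then show "x = y"
      using h_pos by (simp flip: power_mult power_Suc add: ext_frobenius)
  qed
  then have "bij (\<lambda>x :: 'e. x ^ q)"
    using finite_UNIV_inj_surj[OF finite] by (auto simp: bij_def)
  then show ?thesis
    by (simp add: permutation)
qed

text \<open>
  Orbits of a permutation are equal or disjoint, and two representatives with the same orbit
  coincide.
\<close>

lemma card_Union_orbits:
  assumes "orbit_representatives h q (\<Lambda> :: 'e set)"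
  shows "card (\<Union>a\<in>\<Lambda>. orbit (\<lambda>x. x ^ q) a) = h * card \<Lambda>"
proof -
  let ?O = "orbit (\<lambda>x :: 'e. x ^ q)"
  have orbit_eq: "?O y = ?O x" if "y \<in> ?O x" for x y
    using orbit_cyclic_eq3[OF cyclic_on_orbit'[OF permutation_frobenius] that] .
  have self: "x \<in> ?O x" for x
    by (rule permutation_self_in_orbit[OF permutation_frobenius])
  have orbit: "?O a \<in> orbits_of_size h q" if a: "a \<in> \<Lambda>" for a
  proof -
    obtain B where B: "B \<in> orbits_of_size h q" "a \<in> B"
      using assms a unfolding orbit_representatives_def by blast
    then obtain x where "B = ?O x"
      by (auto simp: orbits_of_size_def)
    then show ?thesis
      using B orbit_eq[of a x] by simp
  qed
  have "?O a \<inter> ?O b = {}" if "a \<in> \<Lambda>" "b \<in> \<Lambda>" "a \<noteq> b" for a b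
  proof (rule ccontr)
    assume "?O a \<inter> ?O b \<noteq> {}"
    then obtain y where "y \<in> ?O a" "y \<in> ?O b"
      by blast
    then have "?O a = ?O b"
      using orbit_eq[of y a] orbit_eq[of y b] by simp
    then have in_orbit: "a \<in> \<Lambda> \<inter> ?O a" "b \<in> \<Lambda> \<inter> ?O a"
      using that(1,2) self[of a] self[of b] by simp_all
    have "\<exists>!x. x \<in> \<Lambda> \<inter> ?O a"
      using assms orbit[OF that(1)] unfolding orbit_representatives_def by blast
    then show False
      using in_orbit that(3) by blast
  qed
  then have "card (\<Union>a\<in>\<Lambda>. ?O a) = (\<Sum>a\<in>\<Lambda>. card (?O a))"
    by (intro card_UN_disjoint) auto
  also have "\<dots> = h * card \<Lambda>"
    using orbit by (simp add: orbits_of_size_def)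
  finally show ?thesis .
qed

lemma poly_map_emb_sum:
  assumes "degree f < N"
  shows "poly (map_poly emb f) x = (\<Sum>i<N. emb (coeff f i) * x ^ i)"
proof -
  have "poly (map_poly emb f) x = (\<Sum>i\<le>degree (map_poly emb f). coeff (map_poly emb f) i * x ^ i)"
    by (rule poly_altdef)
  also have "\<dots> = (\<Sum>i<N. coeff (map_poly emb f) i * x ^ i)"
    using assms map_poly_degree_leq[of emb f] by (intro sum.mono_neutral_left) (auto simp: coeff_eq_0)
  finally show ?thesis
    by (simp add: coeff_map_poly)
qed

lemma poly_map_emb_frobenius: "poly (map_poly emb f) (x ^ q) = poly (map_poly emb f) x ^ q"
proof -
  have "poly (map_poly emb f) x ^ q = (\<Sum>i<Suc (degree f). (emb (coeff f i) * x ^ i) ^ q)"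
    using frobenius_power_sum[of "\<lambda>i. emb (coeff f i) * x ^ i" "{..<Suc (degree f)}" 1]
    by (simp only: poly_map_emb_sum[OF lessI] power_one_right)
  also have "\<dots> = (\<Sum>i<Suc (degree f). emb (coeff f i) * (x ^ q) ^ i)"
    using emb_frobenius[of _ 1]
    by (intro sum.cong refl) (simp add: power_mult_distrib mult.commute flip: power_mult)
  finally show ?thesis
    by (simp only: poly_map_emb_sum[OF lessI])
qed

text \<open>
  The roots of a polynomial over the subfield are closed under the Frobenius map, so one root in
  an orbit of size \<open>h\<close> brings along the \<open>h - 1\<close> others.
\<close>

lemma vanishing_on_representatives:
  assumes rep: "orbit_representatives h q \<Lambda>"
    and deg: "degree f < h * card \<Lambda>"
    and zero: "\<And>a. a \<in> \<Lambda> \<Longrightarrow> poly (map_poly emb f) a = 0"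
  shows "f = 0"
proof (rule ccontr)
  assume "f \<noteq> 0"
  let ?R = "{x. poly (map_poly emb f) x = 0}"
  have "y \<in> ?R" if "y \<in> orbit (\<lambda>x. x ^ q) a" "a \<in> \<Lambda>" for a y
    using that by induction (use q_gt_1 zero in \<open>auto simp: poly_map_emb_frobenius\<close>)
  then have "(\<Union>a\<in>\<Lambda>. orbit (\<lambda>x. x ^ q) a) \<subseteq> ?R"
    by blast
  then have "h * card \<Lambda> \<le> card ?R"
    unfolding card_Union_orbits[OF rep, symmetric] by (intro card_mono) auto
  also have "\<dots> \<le> degree (map_poly emb f)"
    using \<open>f \<noteq> 0\<close> by (intro card_poly_roots_bound) (simp add: map_poly_eq_0_iff)
  also have "\<dots> \<le> degree f"
    by (rule map_poly_degree_leq)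
  finally show False
    using deg by simp
qed

lemma ext_vec_space_simps:
  "carrier (ext_vec_space emb n) = carrier_vec n" "\<zero>\<^bsub>ext_vec_space emb n\<^esub> = 0\<^sub>v n"
  "u \<oplus>\<^bsub>ext_vec_space emb n\<^esub> v = u + v" "c \<odot>\<^bsub>ext_vec_space emb n\<^esub> v = emb c \<cdot>\<^sub>v v"
  by (simp_all add: ext_vec_space_def)

lemma finsum_ext_vec_space:
  assumes "finite A" and "f \<in> A \<rightarrow> carrier_vec n"
  shows "finsum (ext_vec_space emb n) f A = vec n (\<lambda>j. \<Sum>v\<in>A. f v $ j)"
proof -
  interpret vectorspace class_ring "ext_vec_space emb n"
    by (rule vectorspace_ext_vec_space[OF hom])
  show ?thesis
    using assms by (induction A) (auto simp: ext_vec_space_simps vec_eq_iff)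
qed

text \<open>
  Linear combinations of the rows of the matrix are evaluations of the polynomial with the same
  coefficients. Spanning, independence and distinctness of the rows thus all become statements
  about polynomials of degree less than \<open>hk\<close>; distinctness matters since bases and linear
  combinations are formed over the set of rows.
\<close>

lemma generator_matrix_G:
  fixes \<alpha> :: "'e vec"
  assumes rep: "orbit_representatives h q (set (list_of_vec \<alpha>))"
    and \<alpha>: "\<alpha> \<in> carrier_vec n" and dist: "distinct (list_of_vec \<alpha>)"
    and k: "1 \<le> k" "k < n"
  shows "generator_matrix emb n (h * k) (code_S emb h k \<alpha>) (matrix_G h k \<alpha>)"
proof -
  define N where "N = h * k"
  define G where "G = matrix_G h k \<alpha>"
  define V where "V = ext_vec_space emb n"
  interpret vectorspace class_ring V
    unfolding V_def by (rule vectorspace_ext_vec_space[OF hom])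
  have card: "card (set (list_of_vec \<alpha>)) = n"
    using distinct_card[OF dist] \<alpha> by simp
  have N: "0 < N" "N < h * n"
    using h_pos k by (auto simp: N_def)
  have G: "G \<in> carrier_mat N n"
    using \<alpha> by (simp add: G_def matrix_G_def N_def)
  have row: "row G i = vec n (\<lambda>j. (\<alpha> $ j) ^ i)" if "i < N" for i
    using that \<alpha> by (auto simp: G_def matrix_G_def N_def vec_eq_iff)
  have rows: "set (rows G) = row G ` {..<N}"
    using G by (auto simp: rows_def)
  have zero: "f = 0" if "degree f < N" "\<And>j. j < n \<Longrightarrow> poly (map_poly emb f) (\<alpha> $ j) = 0" for f
    using that N \<alpha> card by (intro vanishing_on_representatives[OF rep]) (auto simp: set_list_of_vec vec_set_def)
  define P where "P c = (\<Sum>i<N. monom (c i) i)" for c :: "nat \<Rightarrow> 'f"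
  have degP: "degree (P c) < N" for c
    unfolding P_def using N(1) by (intro degree_sum_less) (auto elim: le_less_trans[OF degree_monom_le])
  have coeffP: "coeff (P c) i = c i" if "i < N" for c i
    using that by (simp add: P_def coeff_sum)
  have evalP: "poly (map_poly emb (P c)) x = (\<Sum>i<N. emb (c i) * x ^ i)" for c x
    by (simp add: poly_map_emb_sum[OF degP] coeffP)
  have inj: "inj_on (row G) {..<N}"
  proof (rule inj_onI, rule ccontr)
    fix i i' assume i: "i \<in> {..<N}" "i' \<in> {..<N}" "row G i = row G i'" "i \<noteq> i'"
    \<comment> \<open>The coefficients of \<open>X\<^sup>i - X^i'\<close>, which vanishes at every evaluation point.\<close>
    define c :: "nat \<Rightarrow> 'f" where "c l = of_bool (l = i) - of_bool (l = i')" for l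
    have "P c = 0"
    proof (rule zero[OF degP])
      fix j assume j: "j < n"
      have "emb (c l) * x ^ l = (if l = i then x ^ l else 0) - (if l = i' then x ^ l else 0)" for l x
        using i(4) by (auto simp: c_def hom_distribs)
      then have "poly (map_poly emb (P c)) (\<alpha> $ j) = (\<alpha> $ j) ^ i - (\<alpha> $ j) ^ i'"
        unfolding evalP using i(1,2) by (simp add: sum_subtractf)
      also have "\<dots> = row G i $ j - row G i' $ j"
        using i(1,2) j by (simp add: row)
      finally show "poly (map_poly emb (P c)) (\<alpha> $ j) = 0"
        by (simp add: i(3))
    qed
    then have "c i = 0"
      using coeffP[of i c] i(1) by simp
    then show False
      using i(4) by (simp add: c_def)
  qed
  have lincomb: "lincomb b (set (rows G)) = map_vec (poly (map_poly emb (P (\<lambda>i. b (row G i))))) \<alpha>" for b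
  proof -
    have "lincomb b (set (rows G)) = vec n (\<lambda>j. \<Sum>v\<in>set (rows G). (emb (b v) \<cdot>\<^sub>v v) $ j)"
      unfolding lincomb_def unfolding V_def using G
      by (subst finsum_ext_vec_space) (auto simp: rows ext_vec_space_simps)
    also have "\<dots> = map_vec (poly (map_poly emb (P (\<lambda>i. b (row G i))))) \<alpha>"
    proof (rule eq_vecI)
      fix j assume "j < dim_vec (map_vec (poly (map_poly emb (P (\<lambda>i. b (row G i))))) \<alpha>)"
      then have j: "j < n"
        using \<alpha> by simp
      have "(\<Sum>v\<in>set (rows G). (emb (b v) \<cdot>\<^sub>v v) $ j) = (\<Sum>i<N. (emb (b (row G i)) \<cdot>\<^sub>v row G i) $ j)"
        unfolding rows by (simp only: sum.reindex[OF inj] o_def)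
      also have "\<dots> = (\<Sum>i<N. emb (b (row G i)) * (\<alpha> $ j) ^ i)"
        using j by (intro sum.cong refl) (simp add: row)
      finally show "vec n (\<lambda>j. \<Sum>v\<in>set (rows G). (emb (b v) \<cdot>\<^sub>v v) $ j) $ j =
        map_vec (poly (map_poly emb (P (\<lambda>i. b (row G i))))) \<alpha> $ j"
        using j \<alpha> by (simp add: evalP)
    qed (use \<alpha> in simp)
    finally show ?thesis .
  qed
  have rows_carrier: "set (rows G) \<subseteq> carrier V"
    using G by (auto simp: V_def ext_vec_space_simps rows)
  have span: "span (set (rows G)) = code_S emb h k \<alpha>"
  proof (rule equalityI)
    show "span (set (rows G)) \<subseteq> code_S emb h k \<alpha>"
      unfolding finite_span[OF finite_set rows_carrier] code_S_def lincomb
      using degP by (auto simp: N_def)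
    show "code_S emb h k \<alpha> \<subseteq> span (set (rows G))"
    proof
      fix w assume "w \<in> code_S emb h k \<alpha>"
      then obtain f where f: "degree f < N" "w = map_vec (poly (map_poly emb f)) \<alpha>"
        by (auto simp: code_S_def N_def)
      \<comment> \<open>Combinations are indexed by rows, coefficients by exponents; \<open>inj\<close> translates.\<close>
      define b where "b v = coeff f (the_inv_into {..<N} (row G) v)" for v
      have "P (\<lambda>i. b (row G i)) = f"
      proof (rule poly_eqI)
        fix i
        show "coeff (P (\<lambda>i. b (row G i))) i = coeff f i"
        proof (cases "i < N")
          case True
          then show ?thesis
            by (simp add: coeffP b_def the_inv_into_f_f[OF inj])
        next
          case False
          then show ?thesis
            using degP[of "\<lambda>i. b (row G i)"] f(1) by (simp add: coeff_eq_0)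
        qed
      qed
      then have "w = lincomb b (set (rows G))"
        by (simp add: lincomb f(2))
      then show "w \<in> span (set (rows G))"
        unfolding finite_span[OF finite_set rows_carrier] by auto
    qed
  qed
  have indpt: "lin_indpt (set (rows G))"
  proof (rule finite_lin_indpt2[OF finite_set rows_carrier], rule ballI)
    fix b v assume b: "lincomb b (set (rows G)) = \<zero>\<^bsub>V\<^esub>" and "v \<in> set (rows G)"
    then obtain i where i: "i < N" "v = row G i"
      by (auto simp: rows)
    have "P (\<lambda>i. b (row G i)) = 0"
    proof (rule zero[OF degP])
      fix j assume j: "j < n"
      have "map_vec (poly (map_poly emb (P (\<lambda>i. b (row G i))))) \<alpha> = 0\<^sub>v n"
        using b unfolding lincomb by (simp add: V_def ext_vec_space_simps)
      from arg_cong[OF this, of "\<lambda>v. v $ j"]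
      show "poly (map_poly emb (P (\<lambda>i. b (row G i)))) (\<alpha> $ j) = 0"
        using j \<alpha> by simp
    qed
    then show "b v = \<zero>\<^bsub>class_ring\<^esub>"
      using coeffP[OF i(1), of "\<lambda>i. b (row G i)"] i by simp
  qed
  have sub: "VectorSpace.subspace class_ring (code_S emb h k \<alpha>) V"
    using span_is_subspace[OF rows_carrier] by (simp add: span)
  have "vectorspace.dim class_ring (V\<lparr>carrier := code_S emb h k \<alpha>\<rparr>) = card (set (rows G))"
  proof (rule vectorspace.dim_basis)
    show vs: "vectorspace class_ring (V\<lparr>carrier := code_S emb h k \<alpha>\<rparr>)"
      by (rule subspace_is_vs[OF sub])
    have in_code: "set (rows G) \<subseteq> code_S emb h k \<alpha>"
      using in_own_span[OF rows_carrier] by (simp add: span)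
    have submod: "submodule class_ring (code_S emb h k \<alpha>) V"
      using sub by (simp add: subspace_def)
    show "vectorspace.basis class_ring (V\<lparr>carrier := code_S emb h k \<alpha>\<rparr>) (set (rows G))"
      unfolding vectorspace.basis_def[OF vs]
      using span_li_not_depend[OF in_code submod] indpt in_code by (simp add: span)
  qed simp
  also have "\<dots> = h * k"
    unfolding rows card_image[OF inj] by (simp add: N_def)
  finally show ?thesis
    using sub G span by (simp add: generator_matrix_def linear_code_def V_def G_def N_def)
qed

end

theorem proposition4p7:
  fixes emb :: "'f::{field,finite} \<Rightarrow> 'e::{field,finite}"
    and q h k n :: nat
    and \<Lambda> :: "'e set"
    and \<alpha> \<omega> :: "'e vec"
  assumes "h \<ge> 1"
    and "primepow q"
    and "CARD('f) = q"
    and "CARD('e) = q ^ h"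
    and "field_hom emb"
    and "orbit_representatives h q \<Lambda>"
    and "\<alpha> \<in> carrier_vec n"
    and "distinct (list_of_vec \<alpha>)"
    and "set (list_of_vec \<alpha>) = \<Lambda>"
    and "ordered_basis emb h \<omega>"
    and "1 \<le> k" and "k < n"
    and "q \<ge> h * k + 1"
  shows "generator_matrix emb n (h * k) (code_S emb h k \<alpha>) (matrix_G h k \<alpha>) \<and>
    (\<lambda>\<pi>. subgeometry_point emb (h * k) ` \<pi>) ` matrix_subspaces emb \<omega> (matrix_G h k \<alpha>)
      = pseudo_arc emb h k q \<Lambda>"
proof
  interpret finite_field_extension emb q h
    using assms by (intro finite_field_extension.intro)
  show "generator_matrix emb n (h * k) (code_S emb h k \<alpha>) (matrix_G h k \<alpha>)"
    using assms by (intro generator_matrix_G) auto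
  have col: "col (matrix_G h k \<alpha>) j = vec (h * k) (\<lambda>r. (\<alpha> $ j) ^ r)" if "j < n" for j
    using that assms(7) by (auto simp: matrix_G_def vec_eq_iff)
  have \<Lambda>: "\<Lambda> = ($) \<alpha> ` {..<n}"
    using assms(7,9) by (auto simp: set_list_of_vec vec_set_def)
  have dims: "dim_row (matrix_G h k \<alpha>) = h * k" "dim_col (matrix_G h k \<alpha>) = n"
    using assms(7) by (simp_all add: matrix_G_def)
  define \<pi> where "\<pi> j = pg_subspace (h * k) (vec_space.col_space (h * k)
    (coord_mat emb \<omega> (col (matrix_G h k \<alpha>) j)))" for j
  have "matrix_subspaces emb \<omega> (matrix_G h k \<alpha>) = \<pi> ` {..<n}"
    unfolding matrix_subspaces_def dims \<pi>_def by auto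
  moreover have "subgeometry_point emb (h * k) ` \<pi> j = X_sub emb (h * k) q h (moment_point (h * k) (\<alpha> $ j))"
    if "j < n" for j
    unfolding \<pi>_def col[OF that] by (rule subgeometry_image_col_space[OF assms(10)])
  ultimately have "(\<lambda>\<pi>. subgeometry_point emb (h * k) ` \<pi>) ` matrix_subspaces emb \<omega> (matrix_G h k \<alpha>) =
    (\<lambda>j. X_sub emb (h * k) q h (moment_point (h * k) (\<alpha> $ j))) ` {..<n}"
    by (simp add: image_image)
  then show "(\<lambda>\<pi>. subgeometry_point emb (h * k) ` \<pi>) ` matrix_subspaces emb \<omega> (matrix_G h k \<alpha>)
      = pseudo_arc emb h k q \<Lambda>"
    unfolding pseudo_arc_def \<Lambda> by auto
qed

end
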